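(* Consider the Online Interval Selection problem on inputs that are simple chains, in the random order model. The algorithm Revoke-to-the-Left has competitive ratio exactly $2\left(1-\frac{1}{\sqrt{e}}\right)$ on this class of inputs. That is, $2(1-1/\sqrt{e})$ is the largest real number $\rho$ for which there exists a constant $b$ such that, for every simple chain $I$ of $n\ge 1$ intervals, $\mathbb{E}_\sigma\left[\mathrm{ALG}(I,\sigma)\right]\ \ge\ \rho\cdot \mathrm{OPT}(I)-b$, where $\mathrm{ALG}(I,\sigma)$ is the number of intervals selected at the end by Revoke-to-the-Left when the intervals of $I$ arrive in the order $\sigma$, and $\sigma$ is a uniformly random permutation.
   Context: A simple chain of size $n$ is a set of $n$ unit-length intervals $I_1,\dots,I_n$ on the real line, numbered from left to right, such that $I_i$ and $I_j$ ($i\neq j$) overlap if and only if $|i-j|=1$ (the intersection graph is a path on $n$ vertices in this order). Online Interval Selection (unweighted): intervals arrive one by one; on arrival of each interval the algorithm irrevocably rejects it or accepts it; in the setting with revocable acceptances the algorithm may also revoke (permanently discard) previously accepted intervals when accepting a new one. At all times the currently selected intervals must be pairwise non-overlapping. The value of the algorithm is the number of selected intervals at the end. $\mathrm{OPT}(I)$ is the maximum size of a set of pairwise non-overlapping intervals of $I$ (equal to $\lceil n/2\rceil$ for a simple chain of size $n$). Random order model: the set of intervals is fixed by an adversary and then presented in a uniformly random order; the algorithm's performance is its expected value over this order. Revoke-to-the-Left: when an interval $[s_i,f_i]$ arrives, if it overlaps a currently selected interval $[s_j,f_j]$ with $s_i<f_j<f_i$ (a selected interval on its left side), it is rejected. Otherwise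 it is accepted, and every currently selected interval overlapping it is revoked. On a simple chain: an arriving $I_i$ is rejected if $I_{i-1}$ is currently selected; otherwise $I_i$ is accepted and $I_{i+1}$ is revoked if it is currently selected. *)

theory Defs
  imports "HOL-Probability.Probability" "HOL-Combinatorics.Multiset_Permutations"
begin

text \<open>An interval is given by its start and its finish point.\<close>

type_synonym interval = "real \<times> real"

text \<open>Intervals that merely share an endpoint do not overlap, in accordance with the strict
  inequalities in the rejection rule of the algorithm below.\<close>

definition overlap :: "interval \<Rightarrow> interval \<Rightarrow> bool" where
  "overlap x y \<longleftrightarrow> {fst x<..<snd x} \<inter> {fst y<..<snd y} \<noteq> {}"

definition simple_chain :: "nat \<Rightarrow> interval set \<Rightarrow> bool" where
  "simple_chain n A \<longleftrightarrow>
     (\<exists>J. bij_betw J {1..n} A \<and>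
          (\<forall>i\<in>{1..n}. snd (J i) - fst (J i) = 1) \<and>
          (\<forall>i\<in>{1..n}. \<forall>j\<in>{1..n}. i < j \<longrightarrow> fst (J i) < fst (J j)) \<and>
          (\<forall>i\<in>{1..n}. \<forall>j\<in>{1..n}. i \<noteq> j \<longrightarrow>
             (overlap (J i) (J j) \<longleftrightarrow> \<bar>int i - int j\<bar> = 1)))"

definition OPT :: "interval set \<Rightarrow> nat" where
  "OPT A = Max (card ` {T. T \<subseteq> A \<and> pairwise (\<lambda>x y. \<not> overlap x y) T})"

text \<open>The set \<open>S\<close> holds the currently selected intervals, and \<open>x\<close> is the arriving interval.\<close>

definition revoke_left_step :: "interval \<Rightarrow> interval set \<Rightarrow> interval set" where
  "revoke_left_step x S =
     (if \<exists>y\<in>S. overlap x y \<and> fst x < snd y \<and> snd y < snd x then S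
      else insert x {y\<in>S. \<not> overlap x y})"

text \<open>The list \<open>\<sigma>\<close> is the arrival order, with its head arriving first.\<close>

definition revoke_to_the_left :: "interval list \<Rightarrow> interval set" where
  "revoke_to_the_left \<sigma> = fold revoke_left_step \<sigma> {}"

definition expected_ALG :: "interval set \<Rightarrow> real" where
  "expected_ALG A =
     measure_pmf.expectation (pmf_of_set (permutations_of_set A))
       (\<lambda>\<sigma>. real (card (revoke_to_the_left \<sigma>)))"

definition competitive_on_simple_chains :: "real \<Rightarrow> bool" where
  "competitive_on_simple_chains \<rho> \<longleftrightarrow>
     (\<exists>b::real. \<forall>n A. n \<ge> 1 \<longrightarrow> simple_chain n A \<longrightarrow>
        expected_ALG A \<ge> \<rho> * real (OPT A) - b)"

end

theory Submission
  imports Defs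
begin

text \<open>Whether \<open>I\<^sub>i\<close> ends up selected depends only on the intervals to its left. Let \<open>y\<^sub>i\<close> be the
  probability that it does not. If \<open>I\<^sub>i\<close> arrives last, it is unselected iff \<open>I\<^sub>i\<^sub>-\<^sub>1\<close> is selected; if
  \<open>I\<^sub>i\<^sub>-\<^sub>1\<close> arrives last, iff \<open>I\<^sub>i\<^sub>-\<^sub>2\<close> is unselected; if an earlier \<open>I\<^sub>j\<close> arrives last, it cuts the
  chain and leaves one of length \<open>i - j\<close>. Hence
  \<open>i y\<^sub>i = (1 - y\<^sub>i\<^sub>-\<^sub>1) + y\<^sub>i\<^sub>-\<^sub>2 + (y\<^sub>2 + \<dots> + y\<^sub>i\<^sub>-\<^sub>1)\<close>, so the differences \<open>d\<^sub>k = y\<^sub>k - y\<^sub>k\<^sub>-\<^sub>1\<close> satisfy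
  \<open>k d\<^sub>k = d\<^sub>k\<^sub>-\<^sub>2 - d\<^sub>k\<^sub>-\<^sub>1\<close> and have the generating function \<open>exp (- t + t\<^sup>2 / 2)\<close>. At \<open>t = 1\<close> this
  gives \<open>y\<^sub>i \<rightarrow> 1 / sqrt (exp 1)\<close>, exponentially fast, so that the total error over the chain stays
  bounded.\<close>

section \<open>The limiting constant\<close>

text \<open>The increments \<open>d\<^sub>k\<close>, where \<open>d\<^sub>0 = y\<^sub>0 = 1\<close>.\<close>

fun increment :: "nat \<Rightarrow> real" where
  "increment 0 = 1"
| "increment (Suc 0) = -1"
| "increment (Suc (Suc n)) = (increment n - increment (Suc n)) / (n + 2)"

lemma increment_rec: "(n + 2) * increment (Suc (Suc n)) = increment n - increment (Suc n)"
  by (simp add: field_simps)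

definition unselected_prob :: "nat \<Rightarrow> real" where
  "unselected_prob n = (\<Sum>k\<le>n. increment k)"

lemma unselected_prob_Suc: "unselected_prob (Suc n) = unselected_prob n + increment (Suc n)"
  by (simp add: unselected_prob_def)

lemma unselected_prob_0 [simp]: "unselected_prob 0 = 1"
  by (simp add: unselected_prob_def)

lemma unselected_prob_1 [simp]: "unselected_prob (Suc 0) = 0"
  by (simp add: unselected_prob_def)

text \<open>Subtracting consecutive instances leaves exactly \<open>increment_rec\<close>, so the
  induction step is one use of it.\<close>

lemma unselected_prob_rec:
  "(n + 2) * unselected_prob (Suc (Suc n)) =
     1 - unselected_prob (Suc n) + unselected_prob n + (\<Sum>m=1..n. unselected_prob (Suc m))"
proof (induction n)
  case 0
  show ?case by (simp add: unselected_prob_def)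
next
  case (Suc n)
  show ?case
    using Suc increment_rec[of "Suc n"]
    by (simp del: increment.simps add: unselected_prob_Suc algebra_simps)
qed

section \<open>Decay and generating function of the increments\<close>

lemma abs_increment_le: "\<bar>increment n\<bar> \<le> 64 * (1/2) ^ n"
proof (induction n rule: increment.induct)
  case (3 n)
  show ?case
  proof (cases "n < 4")
    case True
    then have "n = 0 \<or> n = 1 \<or> n = 2 \<or> n = 3" by auto
    then show ?thesis by (auto simp: numeral_eq_Suc)
  next
    case False
    \<comment> \<open>The induction hypotheses give 64 + 32 = 96. Dividing by \<open>n + 2\<close>,
      which is at least 6 here, leaves 16 = 64/4, as two steps of ratio 1/2 demand.\<close>
    have "\<bar>increment n - increment (Suc n)\<bar> \<le> 96 * (1/2) ^ n"
      using 3 by simp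
    also have "\<dots> \<le> (n + 2) * (16 * (1/2) ^ n)"
      using mult_right_mono[of 6 "real n + 2" "16 * (1/2) ^ n"] False by simp
    finally show ?thesis
      by (simp add: field_simps)
  qed
qed auto

lemma summable_increment:
  assumes "\<bar>x\<bar> < 2"
  shows "summable (\<lambda>n. increment n * x ^ n)"
proof (rule summable_comparison_test')
  show "summable (\<lambda>n. 64 * (\<bar>x\<bar> / 2) ^ n)"
    using assms by (intro summable_mult summable_geometric) simp
  show "norm (increment n * x ^ n) \<le> 64 * (\<bar>x\<bar> / 2) ^ n" if "0 \<le> n" for n
    using mult_right_mono[OF abs_increment_le[of n], of "\<bar>x\<bar> ^ n"]
    by (simp add: abs_mult power_abs power_divide)
qed

text \<open>The recurrence becomes the differential equation F' = (x - 1) F, since shifting the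
  coefficients multiplies the series by x.\<close>

lemma diffs_increment_sums:
  assumes "\<bar>x\<bar> < 2"
  shows "(\<lambda>n. diffs increment n * x ^ n) sums ((x - 1) * (\<Sum>n. increment n * x ^ n))"
proof -
  let ?F = "\<Sum>n. increment n * x ^ n"
  have F: "(\<lambda>n. increment n * x ^ n) sums ?F"
    using summable_increment[OF assms] by (rule summable_sums)
  have "(\<lambda>n. increment n * x ^ Suc n) sums (x * ?F)"
    using sums_mult[OF F, of x] by (simp add: mult_ac)
  \<comment> \<open>The prepended zero serves as an increment at index -1, which extends the
    recurrence to \<open>n = 0\<close>.\<close>
  then have "case_nat 0 (\<lambda>m. increment m * x ^ Suc m) sums (x * ?F)"
    using sums_Suc[where f = "case_nat 0 (\<lambda>m. increment m * x ^ Suc m)" and l = "x * ?F"] by simp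
  from sums_diff[OF this F] have
    "(\<lambda>n. case_nat 0 (\<lambda>m. increment m * x ^ Suc m) n - increment n * x ^ n) sums ((x - 1) * ?F)"
    by (simp add: algebra_simps)
  moreover have "diffs increment n * x ^ n =
      case_nat 0 (\<lambda>m. increment m * x ^ Suc m) n - increment n * x ^ n" for n
  proof (cases n)
    case (Suc m)
    have "diffs increment n = increment m - increment n"
      using increment_rec[of m] Suc by (simp del: increment.simps add: diffs_def algebra_simps)
    then show ?thesis
      by (simp only: Suc nat.case left_diff_distrib)
  qed (simp add: diffs_def)
  ultimately show ?thesis by simp
qed

lemma suminf_increment:
  assumes "0 \<le> x" "x < 2"
  shows "(\<Sum>n. increment n * x ^ n) = exp (- x + x\<^sup>2 / 2)"
proof -
  define F where "F = (\<lambda>x. \<Sum>n. increment n * x ^ n)"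
  have F': "(F has_real_derivative (t - 1) * F t) (at t)" if t: "\<bar>t\<bar> < 2" for t
  proof -
    obtain K where K: "\<bar>t\<bar> < K" "K < 2" using dense[OF t] by blast
    then have "((\<lambda>x. \<Sum>n. increment n * x ^ n) has_real_derivative (\<Sum>n. diffs increment n * t ^ n)) (at t)"
      by (intro termdiffs_strong[where K = K] summable_increment) auto
    then show ?thesis
      using diffs_increment_sums[OF t] by (simp add: F_def sums_iff)
  qed
  \<comment> \<open>Integrating factor: F times the reciprocal of the claimed solution has
    derivative zero.\<close>
  have "\<exists>c. \<forall>t\<in>{0..x}. F t * exp (t - t\<^sup>2 / 2) = c"
  proof (rule has_field_derivative_zero_constant)
    fix t assume "t \<in> {0..x}"
    then have "(F has_real_derivative (t - 1) * F t) (at t)"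
      using assms by (intro F') auto
    moreover have "((\<lambda>t. exp (t - t\<^sup>2 / 2)) has_real_derivative (1 - t) * exp (t - t\<^sup>2 / 2)) (at t)"
      by (auto intro!: derivative_eq_intros)
    ultimately have "((\<lambda>t. F t * exp (t - t\<^sup>2 / 2)) has_real_derivative
        (t - 1) * F t * exp (t - t\<^sup>2 / 2) + (1 - t) * exp (t - t\<^sup>2 / 2) * F t) (at t)"
      by (rule DERIV_mult)
    moreover have "(t - 1) * F t * exp (t - t\<^sup>2 / 2) + (1 - t) * exp (t - t\<^sup>2 / 2) * F t = 0"
      by (simp add: left_diff_distrib)
    ultimately show "((\<lambda>t. F t * exp (t - t\<^sup>2 / 2)) has_real_derivative 0) (at t within {0..x})"
      by (simp only: has_field_derivative_at_within)
  qed simp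
  then obtain c where c: "\<And>t. t \<in> {0..x} \<Longrightarrow> F t * exp (t - t\<^sup>2 / 2) = c" by blast
  have "F x * exp (x - x\<^sup>2 / 2) = F 0 * exp (0 - 0\<^sup>2 / 2)"
    using c[of x] c[of 0] assms(1) by simp
  moreover have "F 0 = 1"
    by (simp add: F_def)
  ultimately have "F x = 1 / exp (x - x\<^sup>2 / 2)"
    by (simp add: field_simps)
  also have "\<dots> = exp (- x + x\<^sup>2 / 2)"
    by (simp add: exp_minus[symmetric] inverse_eq_divide[symmetric])
  finally show ?thesis by (simp add: F_def)
qed

lemma increment_sums: "increment sums (1 / sqrt (exp 1))"
proof -
  have "sqrt (exp 1) = exp (1/2)"
    by (rule real_sqrt_unique) (simp_all add: power2_eq_square exp_add[symmetric])
  moreover have "increment sums exp (-1/2)"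
    using summable_increment[of 1] suminf_increment[of 1] by (simp add: sums_iff)
  ultimately show ?thesis
    by (simp add: exp_minus inverse_eq_divide)
qed

lemma unselected_prob_error: "\<bar>unselected_prob n - 1 / sqrt (exp 1)\<bar> \<le> 64 * (1/2) ^ n"
proof -
  have "(\<lambda>k. increment (k + Suc n)) sums (1 / sqrt (exp 1) - unselected_prob n)"
    using sums_split_initial_segment[OF increment_sums, of "Suc n"]
    by (simp only: unselected_prob_def lessThan_Suc_atMost)
  moreover have "(\<lambda>k. 64 * (1/2) ^ (k + Suc n)) sums (64 * (1/2) ^ n :: real)"
    using sums_mult[OF geometric_sums[of "1/2 :: real"], of "32 * (1/2) ^ n"]
    by (simp add: power_add mult_ac)
  ultimately have "norm (1 / sqrt (exp 1) - unselected_prob n) \<le> 64 * (1/2) ^ n"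
    by (rule norm_sums_le) (simp only: real_norm_def abs_increment_le)
  then show ?thesis by (simp add: abs_minus_commute)
qed

text \<open>The errors are dominated by a geometric series, whose full sum from index 0 is 128. This
  bound, uniform in \<open>n\<close>, goes into the additive constant of the competitive
  ratio.\<close>

lemma sum_unselected_prob_error:
  "\<bar>(\<Sum>i=1..n. 1 - unselected_prob i) - real n * (1 - 1 / sqrt (exp 1))\<bar> \<le> 128"
proof -
  have "(\<Sum>i=1..n. 1 - unselected_prob i) - real n * (1 - 1 / sqrt (exp 1)) =
      (\<Sum>i=1..n. 1 / sqrt (exp 1) - unselected_prob i)"
    by (simp add: sum_subtractf algebra_simps)
  also have "\<bar>\<dots>\<bar> \<le> (\<Sum>i=1..n. 64 * (1/2) ^ i)"
    using unselected_prob_error by (intro order_trans[OF sum_abs] sum_mono) (simp add: abs_minus_commute)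
  also have "\<dots> \<le> (\<Sum>i. 64 * (1/2) ^ i)"
    by (intro sum_le_suminf summable_mult summable_geometric) auto
  also have "\<dots> = 128"
    by (subst suminf_mult) (auto simp: suminf_geometric summable_geometric)
  finally show ?thesis .
qed

section \<open>The algorithm on indices\<close>

definition index_step :: "nat \<Rightarrow> nat set \<Rightarrow> nat set" where
  "index_step i T = (if \<exists>k\<in>T. i = Suc k then T else insert i (T - {Suc i}))"

text \<open>Here the last arrival is the head of the list.\<close>

definition index_run :: "nat list \<Rightarrow> nat set" where
  "index_run xs = foldr index_step xs {}"

lemma index_run_Nil [simp]: "index_run [] = {}"
  by (simp add: index_run_def)

lemma index_run_Cons: "index_run (x # xs) = index_step x (index_run xs)"
  by (simp add: index_run_def)

lemma index_run_subset: "index_run xs \<subseteq> set xs"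
  by (induction xs) (auto simp: index_run_Cons index_step_def)

text \<open>Only the left neighbour can cause a rejection or a revocation, and it never
  arrives.\<close>

lemma Suc_in_index_run:
  assumes "Suc k \<in> set xs" "k \<notin> set xs"
  shows "Suc k \<in> index_run xs"
  using assms
proof (induction xs)
  case (Cons x xs)
  then show ?case
    using index_run_subset[of xs] by (cases "x = Suc k") (auto simp: index_run_Cons index_step_def)
qed simp

lemma index_run_last_other:
  assumes "j \<noteq> i" "Suc j \<noteq> i"
  shows "i \<in> index_run (j # xs) \<longleftrightarrow> i \<in> index_run xs"
  using assms by (auto simp: index_run_Cons index_step_def)

lemma index_run_last_self:
  assumes "Suc k \<notin> set xs"
  shows "Suc k \<in> index_run (Suc k # xs) \<longleftrightarrow> k \<notin> index_run xs"
  using assms index_run_subset[of xs] by (auto simp: index_run_Cons index_step_def)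

text \<open>Before the last arrival, \<open>Suc (Suc k)\<close> has no left neighbour and so is
  selected. It is lost exactly if \<open>Suc k\<close> is accepted, that is, if \<open>k\<close> is
  unselected.\<close>

lemma index_run_last_left:
  assumes "Suc (Suc k) \<in> set xs" "Suc k \<notin> set xs"
  shows "Suc (Suc k) \<in> index_run (Suc k # xs) \<longleftrightarrow> k \<in> index_run xs"
  using Suc_in_index_run[OF assms] by (auto simp: index_run_Cons index_step_def)

section \<open>Counting arrival orders by the last arrival\<close>

lemma sum_permutations_of_set_Cons:
  assumes "finite S" "S \<noteq> {}"
  shows "(\<Sum>xs\<in>permutations_of_set S. f xs) =
    (\<Sum>j\<in>S. \<Sum>xs\<in>permutations_of_set (S - {j}). f (j # xs))"
proof -
  have "(\<Sum>xs\<in>permutations_of_set S. f xs) =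
      (\<Sum>j\<in>S. \<Sum>xs\<in>(#) j ` permutations_of_set (S - {j}). f xs)"
    unfolding permutations_of_set_nonempty[OF assms(2)]
    using assms by (intro sum.UNION_disjoint) auto
  also have "\<dots> = (\<Sum>j\<in>S. \<Sum>xs\<in>permutations_of_set (S - {j}). f (j # xs))"
    by (simp add: sum.reindex inj_on_def)
  finally show ?thesis .
qed

text \<open>The average of \<open>last_effect l m\<close> over \<open>m\<close> expresses the probability that the last
  element of a run of length \<open>l\<close> is unselected by conditioning on the position \<open>m\<close> of the last
  arrival in the run.\<close>

definition last_effect :: "nat \<Rightarrow> nat \<Rightarrow> real" where
  "last_effect l m =
     (if m = l then 1 - unselected_prob (l - 1)
      else if Suc m = l then unselected_prob (m - 1)
      else unselected_prob (l - m))"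

lemma sum_last_effect: "(\<Sum>m=1..l. last_effect l m) = l * unselected_prob l"
proof -
  consider "l = 0" | "l = 1" | n where "l = Suc (Suc n)"
    by (metis One_nat_def not0_implies_Suc)
  then show ?thesis
  proof cases
    case 3
    have "(\<Sum>m=1..n. last_effect l m) = (\<Sum>m=1..n. unselected_prob (l - m))"
      using 3 by (intro sum.cong) (auto simp: last_effect_def)
    also have "\<dots> = (\<Sum>m=1..n. unselected_prob (Suc m))"
      by (rule sum.reindex_bij_witness[where i = "\<lambda>m. Suc n - m" and j = "\<lambda>m. Suc n - m"])
        (auto simp: 3 Suc_diff_le)
    finally show ?thesis
      using unselected_prob_rec[of n] 3 by (simp add: last_effect_def algebra_simps)
  qed (auto simp: last_effect_def)
qed

text \<open>Only the maximal run of present indices that ends at \<open>a + l\<close> matters. Stating this for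
  arbitrary index sets makes the induction on the last arrival go through.\<close>

lemma sum_unselected:
  assumes "finite S" "a \<notin> S" "{a+1..a+l} \<subseteq> S"
  shows "(\<Sum>xs\<in>permutations_of_set S. of_bool (a + l \<notin> index_run xs)) =
    fact (card S) * unselected_prob l"
  using assms
proof (induction "card S" arbitrary: S a l)
  case 0
  then have "S = {}" by simp
  with 0 show ?case by (cases l) auto
next
  case (Suc n)
  let ?N = "\<lambda>S i. \<Sum>xs\<in>permutations_of_set S. of_bool (i \<notin> index_run xs) :: real"
  let ?c = "\<lambda>j. \<Sum>xs\<in>permutations_of_set (S - {j}). of_bool (a + l \<notin> index_run (j # xs)) :: real"
  have IH: "?N (S - {j}) (b + k) = fact n * unselected_prob k"
    if "j \<in> S" "b \<notin> S - {j}" "{b+1..b+k} \<subseteq> S - {j}" for j b k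
    using Suc.hyps(1)[of "S - {j}" b k] Suc.hyps(2)[symmetric] Suc.prems(1) that by simp
  have set_perm: "set xs = S - {j}" if "xs \<in> permutations_of_set (S - {j})" for xs j
    using that by (simp add: permutations_of_set_def)
  have other: "?c j = ?N (S - {j}) (a + l)" if "j \<noteq> a + l" "Suc j \<noteq> a + l" for j
    using that by (simp add: index_run_last_other)
  have outside: "?c j = fact n * unselected_prob l" if "j \<in> S - {a+1..a+l}" for j
  \<comment> \<open>For \<open>l = 0\<close> the index \<open>a + l\<close> is absent, hence always
    unselected. \<open>Suc j = a + l\<close> can occur in this case, so \<open>other\<close> does
    not cover it.\<close>
  proof (cases "l = 0")
    case True
    have "?c j = (\<Sum>xs\<in>permutations_of_set (S - {j}). 1)"
      using that True Suc.prems(2) index_run_subset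
      by (intro sum.cong) (fastforce simp: permutations_of_set_def)+
    then show ?thesis using Suc.hyps(2)[symmetric] Suc.prems(1) that True by simp
  next
    case False
    have "j \<noteq> a" using that Suc.prems(2) by auto
    with False that have "j \<noteq> a + l" "Suc j \<noteq> a + l" by auto
    moreover have "?N (S - {j}) (a + l) = fact n * unselected_prob l"
      using that Suc.prems by (intro IH) auto
    ultimately show ?thesis using other by simp
  qed
  have inside: "?c (a + m) = fact n * last_effect l m" if m: "m \<in> {1..l}" for m
  proof -
    have in_S: "a + m \<in> S" using m Suc.prems(3) by auto
    consider "m = l" | "Suc m = l" | "Suc (Suc m) \<le> l" using m by fastforce
    then show ?thesis
    proof cases
      case 1
      then obtain k where k: "l = Suc k" using m by (cases l) auto
      have "?c (a + m) = (\<Sum>xs\<in>permutations_of_set (S - {a + m}). 1 - of_bool (a + k \<notin> index_run xs))"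
        using 1 k set_perm by (intro sum.cong) (auto simp: index_run_last_self)
      also have "\<dots> = fact n - ?N (S - {a + m}) (a + k)"
        using Suc.hyps(2)[symmetric] Suc.prems(1) in_S by (simp add: sum_subtractf)
      also have "?N (S - {a + m}) (a + k) = fact n * unselected_prob k"
        using Suc.prems in_S 1 k by (intro IH) auto
      finally show ?thesis using 1 k by (simp add: last_effect_def algebra_simps)
    next
      case 2
      then obtain k where k: "m = Suc k" using m by (cases m) auto
      have "a + l \<in> S" using m Suc.prems(3) by auto
      then have "?c (a + m) = ?N (S - {a + m}) (a + k)"
        using 2 k set_perm by (intro sum.cong) (auto simp: index_run_last_left)
      also have "\<dots> = fact n * unselected_prob k"
        using Suc.prems in_S 2 k by (intro IH) auto
      finally show ?thesis using 2 k by (simp add: last_effect_def)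
    next
      case 3
      \<comment> \<open>The removed index \<open>a + m\<close> becomes the absent point before a run
        of length \<open>l - m\<close>.\<close>
      then have "?c (a + m) = ?N (S - {a + m}) ((a + m) + (l - m))"
        using other[of "a + m"] by simp
      also have "\<dots> = fact n * unselected_prob (l - m)"
        using Suc.prems in_S 3 m by (intro IH) auto
      finally show ?thesis using 3 by (simp add: last_effect_def)
    qed
  qed
  have "?N S (a + l) = (\<Sum>j\<in>S. ?c j)"
    using Suc.hyps(2)[symmetric] Suc.prems(1) by (intro sum_permutations_of_set_Cons) auto
  also have "\<dots> = (\<Sum>j\<in>S - {a+1..a+l}. ?c j) + (\<Sum>j\<in>{a+1..a+l}. ?c j)"
    using Suc.prems by (intro sum.subset_diff) auto
  also have "(\<Sum>j\<in>{a+1..a+l}. ?c j) = (\<Sum>m\<in>{1..l}. ?c (a + m))"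
    by (rule sum.reindex_bij_witness[where i = "\<lambda>m. a + m" and j = "\<lambda>j. j - a"]) auto
  also have "\<dots> = (\<Sum>m\<in>{1..l}. fact n * last_effect l m)"
    using inside by (rule sum.cong[OF refl])
  also have "\<dots> = fact n * (l * unselected_prob l)"
    by (simp only: sum_distrib_left[symmetric] sum_last_effect)
  also have "(\<Sum>j\<in>S - {a+1..a+l}. ?c j) = (\<Sum>j\<in>S - {a+1..a+l}. fact n * unselected_prob l)"
    using outside by (rule sum.cong[OF refl])
  \<comment> \<open>The \<open>Suc n - l\<close> outside indices and the weight \<open>l\<close>
    from inside add up to \<open>Suc n\<close> equal shares.\<close>
  also have "\<dots> = (real (Suc n) - l) * (fact n * unselected_prob l)"
    using Suc.prems Suc.hyps(2)[symmetric] card_mono[OF Suc.prems(1,3)]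
    by (simp add: card_Diff_subset of_nat_diff)
  finally show ?case
    using Suc.hyps(2)[symmetric] by (simp add: algebra_simps)
qed

lemma sum_card_index_run:
  "(\<Sum>xs\<in>permutations_of_set {1..n}. real (card (index_run xs))) =
    fact n * (\<Sum>i=1..n. 1 - unselected_prob i)"
proof -
  have "real (card (index_run xs)) = (\<Sum>i=1..n. 1 - of_bool (i \<notin> index_run xs))"
    if "xs \<in> permutations_of_set {1..n}" for xs
  proof -
    have "index_run xs = {i\<in>{1..n}. i \<in> index_run xs}"
      using index_run_subset[of xs] that by (auto simp: permutations_of_set_def)
    then have "real (card (index_run xs)) = real (card {i\<in>{1..n}. i \<in> index_run xs})"
      by (rule arg_cong)
    also have "\<dots> = (\<Sum>i=1..n. of_bool (i \<in> index_run xs))"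
      by (simp add: sum.If_cases of_bool_def Int_def)
    finally show ?thesis by (simp add: of_bool_not_iff)
  qed
  then have "(\<Sum>xs\<in>permutations_of_set {1..n}. real (card (index_run xs))) =
      (\<Sum>i=1..n. \<Sum>xs\<in>permutations_of_set {1..n}. 1 - of_bool (i \<notin> index_run xs))"
    by (subst sum.swap) simp
  also have "\<dots> = (\<Sum>i=1..n. fact n * (1 - unselected_prob i))"
  proof (rule sum.cong)
    fix i assume "i \<in> {1..n}"
    then show "(\<Sum>xs\<in>permutations_of_set {1..n}. 1 - of_bool (i \<notin> index_run xs)) =
        fact n * (1 - unselected_prob i)"
      \<comment> \<open>Index 0 is absent, so the run ending at \<open>i\<close> is all of
        \<open>{1..i}\<close>.\<close>
      using sum_unselected[of "{1..n}" 0 i] by (simp add: sum_subtractf algebra_simps)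
  qed simp
  finally show ?thesis by (simp add: sum_distrib_left)
qed

section \<open>Simple chains\<close>

locale chain =
  fixes n :: nat and J :: "nat \<Rightarrow> interval"
  assumes unit_length: "\<And>i. i \<in> {1..n} \<Longrightarrow> snd (J i) - fst (J i) = 1"
    and start_mono: "\<And>i j. i \<in> {1..n} \<Longrightarrow> j \<in> {1..n} \<Longrightarrow> i < j \<Longrightarrow> fst (J i) < fst (J j)"
    and overlap_iff: "\<And>i j. i \<in> {1..n} \<Longrightarrow> j \<in> {1..n} \<Longrightarrow> i \<noteq> j \<Longrightarrow>
      overlap (J i) (J j) \<longleftrightarrow> \<bar>int i - int j\<bar> = 1"
begin

lemma start_less_iff:
  assumes "i \<in> {1..n}" "j \<in> {1..n}"
  shows "fst (J i) < fst (J j) \<longleftrightarrow> i < j"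
  using start_mono[of i j] start_mono[of j i] assms by (cases i j rule: linorder_cases) auto

lemma inj_J: "inj_on J {1..n}"
  by (rule inj_onI) (metis start_less_iff linorder_neqE_nat less_irrefl)

text \<open>Equal lengths order the finishes like the starts, so the rule singles out the
  overlapping interval on the left.\<close>

lemma reject_iff:
  assumes "i \<in> {1..n}" "j \<in> {1..n}"
  shows "overlap (J i) (J j) \<and> fst (J i) < snd (J j) \<and> snd (J j) < snd (J i) \<longleftrightarrow> i = Suc j"
proof -
  have "overlap (J i) (J j) \<Longrightarrow> fst (J i) < snd (J j)"
    by (auto simp: overlap_def)
  moreover have "snd (J j) < snd (J i) \<longleftrightarrow> j < i"
    using unit_length[OF assms(1)] unit_length[OF assms(2)] start_less_iff[OF assms(2,1)] by auto
  ultimately show ?thesis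
    using overlap_iff[OF assms] by (cases "i = j") auto
qed

lemma revoke_left_step_image:
  assumes "i \<in> {1..n}" "T \<subseteq> {1..n}"
  shows "revoke_left_step (J i) (J ` T) = J ` index_step i T"
proof (cases "\<exists>k\<in>T. i = Suc k")
  case True
  then have "\<exists>y\<in>J ` T. overlap (J i) y \<and> fst (J i) < snd y \<and> snd y < snd (J i)"
    using reject_iff[OF assms(1)] assms(2) by blast
  with True show ?thesis by (simp add: revoke_left_step_def index_step_def)
next
  case False
  then have no: "\<not> (\<exists>y\<in>J ` T. overlap (J i) y \<and> fst (J i) < snd y \<and> snd y < snd (J i))"
    using reject_iff[OF assms(1)] assms(2) by blast
  \<comment> \<open>With the left neighbour unselected, only the right one can conflict.
    \<open>k = i\<close> is set aside because \<open>insert i\<close> restores it anyway.\<close>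
  have "overlap (J i) (J k) \<longleftrightarrow> k = Suc i" if "k \<in> T" "k \<noteq> i" for k
  proof -
    have "k \<in> {1..n}" "i \<noteq> Suc k" using that False assms by auto
    then show ?thesis using overlap_iff[OF assms(1), of k] that by auto
  qed
  then have "insert i {k \<in> T. \<not> overlap (J i) (J k)} = insert i (T - {Suc i})"
    by force
  moreover have "insert (J i) {y \<in> J ` T. \<not> overlap (J i) y} =
      J ` insert i {k \<in> T. \<not> overlap (J i) (J k)}"
    by auto
  ultimately show ?thesis
    unfolding revoke_left_step_def index_step_def if_not_P[OF False] if_not_P[OF no] by simp
qed

lemma foldr_revoke_left_step:
  assumes "set xs \<subseteq> {1..n}"
  shows "foldr revoke_left_step (map J xs) {} = J ` index_run xs"
  using assms
proof (induction xs)
  case (Cons x xs)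
  then have "index_run xs \<subseteq> {1..n}"
    using index_run_subset[of xs] by auto
  with Cons show ?case by (simp add: index_run_Cons revoke_left_step_image)
qed simp

lemma expected_ALG_eq: "expected_ALG (J ` {1..n}) = (\<Sum>i=1..n. 1 - unselected_prob i)"
proof -
  let ?P = "permutations_of_set {1..n}"
  have "expected_ALG (J ` {1..n}) =
      (\<Sum>\<sigma>\<in>map J ` ?P. real (card (revoke_to_the_left \<sigma>))) / card (map J ` ?P)"
    unfolding expected_ALG_def permutations_of_set_image_inj[OF inj_J]
    by (intro integral_pmf_of_set) auto
  also have "inj_on (map J) ?P"
    using inj_J by (intro inj_on_mapI) (auto simp: permutations_of_set_def)
  then have "(\<Sum>\<sigma>\<in>map J ` ?P. real (card (revoke_to_the_left \<sigma>))) / card (map J ` ?P) =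
      (\<Sum>xs\<in>?P. real (card (revoke_to_the_left (map J xs)))) / fact n"
    by (simp add: sum.reindex card_image)
  \<comment> \<open>Reversal permutes the arrival orders and reconciles the two list conventions:
    first arrival at the head here, last arrival at the head in \<open>index_run\<close>.\<close>
  also have "(\<Sum>xs\<in>?P. real (card (revoke_to_the_left (map J xs)))) =
      (\<Sum>xs\<in>rev ` ?P. real (card (revoke_to_the_left (map J xs))))"
    by simp
  also have "\<dots> = (\<Sum>xs\<in>?P. real (card (revoke_to_the_left (map J (rev xs)))))"
    by (subst sum.reindex) (auto intro: inj_onI)
  also have "\<dots> = (\<Sum>xs\<in>?P. real (card (index_run xs)))"
  proof (rule sum.cong)
    fix xs assume "xs \<in> ?P"
    then have xs: "set xs = {1..n}" by (simp add: permutations_of_set_def)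
    then have "revoke_to_the_left (map J (rev xs)) = J ` index_run xs"
      using foldr_revoke_left_step[of xs] by (simp add: revoke_to_the_left_def foldr_conv_fold rev_map)
    moreover have "inj_on J (index_run xs)"
      using inj_J index_run_subset[of xs] xs by (auto intro: inj_on_subset)
    ultimately show "real (card (revoke_to_the_left (map J (rev xs)))) = real (card (index_run xs))"
      by (simp add: card_image)
  qed simp
  finally show ?thesis
    unfolding sum_card_index_run by simp
qed

section \<open>The optimum of a chain\<close>

abbreviation independent :: "interval set \<Rightarrow> bool" where
  "independent \<equiv> pairwise (\<lambda>x y. \<not> overlap x y)"

text \<open>The index set of \<open>T\<close> and its shift by one are disjoint subsets of
  \<open>{1..n+1}\<close>.\<close>

lemma card_independent_le:
  assumes "T \<subseteq> J ` {1..n}" "independent T"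
  shows "2 * card T \<le> n + 1"
proof -
  obtain U where U: "U \<subseteq> {1..n}" "T = J ` U" using assms(1) by (auto simp: subset_image_iff)
  have inj: "inj_on J U" using inj_J U(1) by (rule inj_on_subset)
  have "finite U" using U(1) finite_subset by blast
  have "U \<inter> Suc ` U = {}"
  proof safe
    fix k assume k: "Suc k \<in> U" "k \<in> U"
    then have "J (Suc k) \<noteq> J k" using inj by (auto dest: inj_onD)
    then have "\<not> overlap (J (Suc k)) (J k)"
      using k U(2) assms(2) by (auto simp: pairwise_def)
    moreover have "Suc k \<in> {1..n}" "k \<in> {1..n}" using k U(1) by blast+
    ultimately show "Suc k \<in> {}" using overlap_iff[of "Suc k" k] by auto
  qed
  then have "card (U \<union> Suc ` U) = 2 * card U"
    using \<open>finite U\<close> by (simp add: card_Un_disjoint card_image)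
  moreover have "card (U \<union> Suc ` U) \<le> card {1..n+1}"
    using U(1) by (intro card_mono) auto
  ultimately show ?thesis using inj U(2) by (simp add: card_image)
qed

lemma OPT_bounds: "n \<le> 2 * OPT (J ` {1..n})" "2 * OPT (J ` {1..n}) \<le> n + 1"
proof -
  let ?C = "card ` {T. T \<subseteq> J ` {1..n} \<and> independent T}"
  have fin: "finite ?C" by simp
  have "0 \<in> ?C" by (rule image_eqI[of _ _ "{}"]) auto
  then have "OPT (J ` {1..n}) \<in> ?C"
    unfolding OPT_def using fin by (intro Max_in) blast+
  then show "2 * OPT (J ` {1..n}) \<le> n + 1"
    using card_independent_le by auto
  \<comment> \<open>The odd indices are independent, as their differences are even and never
    1.\<close>
  let ?U = "(\<lambda>k. 2 * k + 1) ` {..<(n + 1) div 2}"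
  have U: "?U \<subseteq> {1..n}" by auto
  have "independent (J ` ?U)"
  proof (rule pairwiseI)
    fix x y assume "x \<in> J ` ?U" "y \<in> J ` ?U" "x \<noteq> y"
    then obtain k l where kl: "x = J (2 * k + 1)" "y = J (2 * l + 1)" "2 * k + 1 \<in> ?U" "2 * l + 1 \<in> ?U" "k \<noteq> l"
      by auto
    then have "overlap x y \<longleftrightarrow> \<bar>int (2 * k + 1) - int (2 * l + 1)\<bar> = 1"
      unfolding kl(1,2) by (intro overlap_iff subsetD[OF U]) auto
    then show "\<not> overlap x y" by presburger
  qed
  then have "card (J ` ?U) \<in> ?C" using U by blast
  moreover have "card (J ` ?U) = (n + 1) div 2"
    using inj_on_subset[OF inj_J U] by (simp add: card_image inj_on_def)
  ultimately have "(n + 1) div 2 \<in> ?C" by (simp only:)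
  then have "(n + 1) div 2 \<le> OPT (J ` {1..n})"
    unfolding OPT_def by (rule Max_ge[OF fin])
  then show "n \<le> 2 * OPT (J ` {1..n})" by linarith
qed

end

section \<open>The competitive ratio\<close>

lemma simple_chainE:
  assumes "simple_chain n A"
  obtains J where "chain n J" "A = J ` {1..n}"
  using assms unfolding simple_chain_def chain_def bij_betw_def by metis

text \<open>Chains of every size are needed for optimality. At spacing 3/4, neighbours are less than
  1 apart and all other pairs at least 3/2.\<close>

lemma chain_exists: "chain n (\<lambda>i. (3/4 * real i, 3/4 * real i + 1))"
proof
  fix i j :: nat
  assume "i \<noteq> j"
  have "overlap (3/4 * real i, 3/4 * real i + 1) (3/4 * real j, 3/4 * real j + 1) \<longleftrightarrow>
      3 * i < 3 * j + 4 \<and> 3 * j < 3 * i + 4"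
    by (auto simp: overlap_def)
  with \<open>i \<noteq> j\<close> show "overlap (3/4 * real i, 3/4 * real i + 1) (3/4 * real j, 3/4 * real j + 1) \<longleftrightarrow>
      \<bar>int i - int j\<bar> = 1"
    by presburger
qed auto

lemma (in chain) simple_chain_image: "simple_chain n (J ` {1..n})"
  unfolding simple_chain_def using inj_J unit_length start_mono overlap_iff
  by (intro exI[of _ J]) (simp add: inj_on_imp_bij_betw)

theorem theorem2:
  shows "competitive_on_simple_chains (2 * (1 - 1 / sqrt (exp 1))) \<and>
    (\<forall>\<rho>. competitive_on_simple_chains \<rho> \<longrightarrow> \<rho> \<le> 2 * (1 - 1 / sqrt (exp 1)))"
proof (intro conjI allI impI)
  define c :: real where "c = 1 - 1 / sqrt (exp 1)"
  have c: "0 \<le> c" "c \<le> 1" by (auto simp: c_def)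
  have error: "\<bar>expected_ALG (J ` {1..n}) - real n * c\<bar> \<le> 128" if "chain n J" for n J
    unfolding c_def chain.expected_ALG_eq[OF that] by (rule sum_unselected_prob_error)
  have "expected_ALG A \<ge> 2 * c * real (OPT A) - 129" if A: "simple_chain n A" for n A
  proof -
    obtain J where J: "chain n J" "A = J ` {1..n}" using A by (rule simple_chainE)
    \<comment> \<open>Rounding in the optimum costs at most \<open>c\<close>, hence at most 1, which
      explains 129 = 128 + 1.\<close>
    have "c * real (2 * OPT A) \<le> c * real (n + 1)"
      using chain.OPT_bounds(2)[OF J(1)] c J(2) by (intro mult_left_mono) (simp_all only: of_nat_le_iff)
    then have "2 * c * real (OPT A) \<le> real n * c + 1"
      using c(2) by (simp add: algebra_simps)
    then show ?thesis
      using error[OF J(1)] unfolding J(2) by linarith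
  qed
  then show "competitive_on_simple_chains (2 * (1 - 1 / sqrt (exp 1)))"
    unfolding competitive_on_simple_chains_def c_def by blast
  fix \<rho> assume "competitive_on_simple_chains \<rho>"
  then obtain b where b: "\<And>n A. n \<ge> 1 \<Longrightarrow> simple_chain n A \<Longrightarrow> expected_ALG A \<ge> \<rho> * real (OPT A) - b"
    unfolding competitive_on_simple_chains_def by blast
  show "\<rho> \<le> 2 * (1 - 1 / sqrt (exp 1))"
  proof (rule ccontr)
    assume "\<not> ?thesis"
    then have \<rho>: "\<rho> > 2 * c" by (simp add: c_def)
    \<comment> \<open>A ratio above \<open>2 * c\<close> would gain linearly in \<open>n\<close> and
      outgrow both constants.\<close>
    obtain n where n: "n \<ge> 1" "(\<rho> / 2 - c) * real n > 128 + b"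
    proof -
      obtain m where "128 + b < real m * (\<rho> / 2 - c)"
        using reals_Archimedean3[of "\<rho> / 2 - c"] \<rho> by auto
      also have "\<dots> \<le> real (Suc m) * (\<rho> / 2 - c)"
        using \<rho> by (intro mult_right_mono) auto
      finally show ?thesis by (intro that[of "Suc m"]) (auto simp: mult.commute)
    qed
    obtain J where J: "chain n J" using chain_exists by blast
    have "(\<rho> / 2) * real n \<le> (\<rho> / 2) * real (2 * OPT (J ` {1..n}))"
      using chain.OPT_bounds(1)[OF J] \<rho> c by (intro mult_left_mono) auto
    also have "\<dots> \<le> real n * c + 128 + b"
      using b[OF n(1) chain.simple_chain_image[OF J]] error[OF J] by simp
    finally show False using n(2) by (simp add: algebra_simps)
  qed
qed

end
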